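(* Let $k \ge 4$ be an integer such that a Hadamard matrix of order $k$ exists, and let $n \ge 1$ be an integer. Then $$f_k(n) \le \left\lceil n^{\frac{1}{k-1}} \right\rceil^{k/2 - 1}.$$
   Context: $[n]=\{1,\ldots,n\}$. A permutation $\pi$ on $[n]$ is identified with the sequence $\pi(1)\ \pi(2)\ \cdots\ \pi(n)$. A subsequence need not consist of consecutive terms. Given $k\ge 2$ permutations $\pi_1,\ldots,\pi_k$ on $[n]$ (an indexed family, repetitions allowed), a sequence $a_1\ \cdots\ a_m$ is a common subsequence of the family if there are distinct indices $i\neq j$ such that $a_1\ \cdots\ a_m$ is a subsequence of both $\pi_i(1)\ \cdots\ \pi_i(n)$ and $\pi_j(1)\ \cdots\ \pi_j(n)$. $f_k(n)$ denotes the maximum integer $m$ such that every family of $k$ permutations on $[n]$ contains a common subsequence of length $m$. A Hadamard matrix of order $k$ is a $k\times k$ matrix with entries in $\{+1,-1\}$ such that every two distinct rows differ in exactly $k/2$ entries. *)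

theory Defs
  imports Complex_Main "HOL-Combinatorics.Permutations" "HOL-Library.Sublist"
    "Jordan_Normal_Form.Matrix"
begin

definition perm_seq :: "nat \<Rightarrow> (nat \<Rightarrow> nat) \<Rightarrow> nat list" where
  "perm_seq n p = map p [1..<Suc n]"

definition perm_family :: "nat \<Rightarrow> nat \<Rightarrow> (nat \<Rightarrow> nat \<Rightarrow> nat) \<Rightarrow> bool" where
  "perm_family k n \<pi> \<longleftrightarrow> (\<forall>i\<in>{1..k}. \<pi> i permutes {1..n})"

text \<open>\<^const>\<open>subseq\<close> does not require the chosen terms to be consecutive. It is enough that
  two of the \<open>k\<close> permutations share the sequence.\<close>

definition common_subseq :: "nat \<Rightarrow> nat \<Rightarrow> (nat \<Rightarrow> nat \<Rightarrow> nat) \<Rightarrow> nat list \<Rightarrow> bool" where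
  "common_subseq k n \<pi> a \<longleftrightarrow>
     (\<exists>i\<in>{1..k}. \<exists>j\<in>{1..k}. i \<noteq> j \<and>
        subseq a (perm_seq n (\<pi> i)) \<and> subseq a (perm_seq n (\<pi> j)))"

text \<open>Meaningful for \<open>k \<ge> 2\<close> only: without two distinct indices no \<open>m\<close> qualifies.\<close>

definition lcs_bound :: "nat \<Rightarrow> nat \<Rightarrow> nat" where
  "lcs_bound k n =
     (GREATEST m. \<forall>\<pi>. perm_family k n \<pi> \<longrightarrow> (\<exists>a. common_subseq k n \<pi> a \<and> length a = m))"

definition hadamard_matrix :: "nat \<Rightarrow> int mat \<Rightarrow> bool" where
  "hadamard_matrix k H \<longleftrightarrow>
     H \<in> carrier_mat k k \<and>
     (\<forall>i<k. \<forall>j<k. H $$ (i, j) \<in> {1, -1}) \<and>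
     (\<forall>i<k. \<forall>i'<k. i \<noteq> i' \<longrightarrow>
        real (card {j. j < k \<and> H $$ (i, j) \<noteq> H $$ (i', j)}) = real k / 2)"

lemma lcs_bound_is_maximum:
  fixes k n :: nat
  assumes "k \<ge> 2"
  defines "P \<equiv> \<lambda>m. \<forall>\<pi>. perm_family k n \<pi> \<longrightarrow> (\<exists>a. common_subseq k n \<pi> a \<and> length a = m)"
  shows "P (lcs_bound k n)" and "P m \<Longrightarrow> m \<le> lcs_bound k n"
proof -
  have bnd: "m \<le> n" if "P m" for m
  proof -
    have "perm_family k n (\<lambda>_. id)"
      by (simp add: perm_family_def permutes_id)
    with that obtain a where a: "common_subseq k n (\<lambda>_. id) a" "length a = m"
      unfolding P_def by blast
    then have "length a \<le> length (perm_seq n id)"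
      unfolding common_subseq_def using list_emb_length by blast
    with a show ?thesis by (simp add: perm_seq_def del: upt_Suc)
  qed
  have "common_subseq k n \<pi> []" for \<pi>
    unfolding common_subseq_def using assms(1)
    by (intro bexI[of _ 1] bexI[of _ 2]) auto
  then have "P 0" unfolding P_def by (metis list.size(3))
  show "P (lcs_bound k n)"
    unfolding lcs_bound_def P_def[symmetric]
    using GreatestI_nat[of P 0 n] \<open>P 0\<close> bnd by (simp add: P_def)
  show "P m \<Longrightarrow> m \<le> lcs_bound k n"
    unfolding lcs_bound_def
    using Greatest_le_nat[of P m n] bnd by (simp add: P_def)
qed

end

theory Submission
  imports Defs
begin

text \<open>
  Let \<open>b = \<lceil>n powr (1 / (k - 1))\<rceil>\<close>, so that \<open>n \<le> b ^ (k - 1)\<close> and \<open>{1..n}\<close> can be labelled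
  injectively by words of length \<open>k - 1\<close> over \<open>{..<b}\<close>.  A sign vector \<open>s\<close> gives each word \<open>w\<close> the
  integer \<open>\<Sum>c. s c * w c * b ^ c\<close>.  Distinct words get distinct values, so every sign vector
  sorts \<open>{1..n}\<close> into a permutation (this is the lexicographic order, with the direction of each
  coordinate prescribed by its sign).

  A sequence common to the permutations of two sign vectors \<open>s\<close> and \<open>t\<close> is strictly increasing
  for both values, hence for their sum.  In the sum every coordinate with \<open>s c = - t c\<close> cancels,
  so the sum takes at most \<open>b ^ m\<close> values, where \<open>m\<close> is the number of coordinates on which \<open>s\<close> and
  \<open>t\<close> agree, and the sequence has at most \<open>b ^ m\<close> terms (lemma \<open>lcs_bound_le_power\<close>).

  Multiplying each row of a Hadamard matrix by its own first entry makes the first column constant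
  and leaves distinct rows differing in exactly \<open>k/2\<close> places.  Deleting that column leaves \<open>k\<close>
  sign vectors of length \<open>k - 1\<close>, any two of which agree in \<open>k/2 - 1\<close> places.
\<close>

section \<open>Words valued with signs\<close>

lemma balanced_expansion_eq_0:
  fixes e :: "nat \<Rightarrow> int"
  assumes "\<And>c. c < d \<Longrightarrow> \<bar>e c\<bar> < b" and "(\<Sum>c<d. e c * b ^ c) = 0" and "c < d"
  shows "e c = 0"
  using assms
proof (induction d arbitrary: e c)
  case 0
  then show ?case by simp
next
  case (Suc d)
  let ?r = "\<Sum>c<d. e (Suc c) * b ^ c"
  have eq: "e 0 + b * ?r = 0"
    using Suc.prems(2) by (simp add: sum.lessThan_Suc_shift sum_distrib_left algebra_simps
        del: sum.lessThan_Suc)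
  have "b dvd e 0"
    using eq by (metis dvd_add_left_iff dvd_0_right dvd_triv_left)
  moreover have "\<bar>e 0\<bar> < b" using Suc.prems(1) by simp
  ultimately have e0: "e 0 = 0"
    using dvd_imp_le_int[of "e 0" b] by linarith
  have "b \<noteq> 0" using \<open>\<bar>e 0\<bar> < b\<close> by auto
  with eq e0 have "?r = 0" by simp
  then have "e (Suc c) = 0" if "c < d" for c
    using Suc.IH[of "\<lambda>c. e (Suc c)" c] Suc.prems(1) that by simp
  with e0 Suc.prems(3) show ?case by (cases c) auto
qed

definition signed_value :: "nat \<Rightarrow> nat \<Rightarrow> (nat \<Rightarrow> int) \<Rightarrow> (nat \<Rightarrow> nat) \<Rightarrow> int" where
  "signed_value b d s w = (\<Sum>c<d. s c * int (w c) * int b ^ c)"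

lemma inj_on_signed_value:
  assumes sgn: "\<And>c. c < d \<Longrightarrow> s c \<in> {1, -1}"
  shows "inj_on (signed_value b d s) ({..<d} \<rightarrow>\<^sub>E {..<b})"
proof (rule inj_onI)
  fix v w assume v: "v \<in> {..<d} \<rightarrow>\<^sub>E {..<b}" and w: "w \<in> {..<d} \<rightarrow>\<^sub>E {..<b}"
    and eq: "signed_value b d s v = signed_value b d s w"
  let ?e = "\<lambda>c. s c * (int (v c) - int (w c))"
  have "(\<Sum>c<d. ?e c * int b ^ c) = 0"
    using eq by (simp add: signed_value_def algebra_simps sum_subtractf)
  moreover have "\<bar>?e c\<bar> < int b" if "c < d" for c
  proof -
    have "v c < b" "w c < b" using v w that by auto
    then show ?thesis using sgn[OF that] by auto
  qed
  ultimately have "?e c = 0" if "c < d" for c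
    using balanced_expansion_eq_0[of d ?e "int b"] that by blast
  then have "v c = w c" if "c < d" for c
    using sgn[OF that] that by fastforce
  then show "v = w" by (intro PiE_ext[OF v w]) auto
qed

text \<open>Coordinates with opposite signs cancel in the sum of the two values, which is therefore
  determined by the restriction of the word to the coordinates with equal signs.\<close>

lemma card_signed_value_sum_le:
  assumes "\<And>c. c < d \<Longrightarrow> s c \<in> {1, -1}" and "\<And>c. c < d \<Longrightarrow> t c \<in> {1, -1}"
    and X: "X \<subseteq> {..<d} \<rightarrow>\<^sub>E {..<b}"
  shows "card ((\<lambda>w. signed_value b d s w + signed_value b d t w) ` X)
           \<le> b ^ card {c. c < d \<and> s c = t c}"
proof -
  let ?A = "{c. c < d \<and> s c = t c}"
  let ?h = "\<lambda>w. \<Sum>c\<in>?A. 2 * s c * int (w c) * int b ^ c"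
  have sum_eq: "signed_value b d s w + signed_value b d t w = ?h (restrict w ?A)" for w
  proof -
    have "signed_value b d s w + signed_value b d t w
            = (\<Sum>c<d. (s c + t c) * int (w c) * int b ^ c)"
      by (simp add: signed_value_def sum.distrib algebra_simps)
    also have "\<dots> = (\<Sum>c\<in>?A. (s c + t c) * int (w c) * int b ^ c)"
      by (rule sum.mono_neutral_right) (use assms(1,2) in force)+
    also have "\<dots> = ?h (restrict w ?A)"
      by (rule sum.cong) auto
    finally show ?thesis .
  qed
  have "(\<lambda>w. signed_value b d s w + signed_value b d t w) ` X
          \<subseteq> ?h ` (?A \<rightarrow>\<^sub>E {..<b})"
  proof (rule image_subsetI)
    fix w assume "w \<in> X"
    then have "restrict w ?A \<in> ?A \<rightarrow>\<^sub>E {..<b}" using X by (auto simp: PiE_iff)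
    then show "signed_value b d s w + signed_value b d t w \<in> ?h ` (?A \<rightarrow>\<^sub>E {..<b})"
      unfolding sum_eq by (rule imageI)
  qed
  moreover have fin: "finite (?A \<rightarrow>\<^sub>E {..<b})" by (intro finite_PiE) auto
  ultimately have "card ((\<lambda>w. signed_value b d s w + signed_value b d t w) ` X)
                     \<le> card (?A \<rightarrow>\<^sub>E {..<b})"
    by (meson card_image_le card_mono finite_imageI order_trans)
  also have "\<dots> = b ^ card ?A" by (simp add: card_PiE)
  finally show ?thesis .
qed

section \<open>Permutations sorted by keys\<close>

lemma ex_permutation_sorted_by_key:
  fixes key :: "nat \<Rightarrow> 'a::linorder"
  assumes "inj_on key {1..n}"
  shows "\<exists>p. p permutes {1..n} \<and> sorted_wrt (\<lambda>x y. key x < key y) (perm_seq n p)"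
proof -
  define xs where "xs = sort_key key [1..<Suc n]"
  define p where "p x = (if x \<in> {1..n} then xs ! (x - 1) else x)" for x
  have set_xs: "set xs = {1..n}" and len: "length xs = n" and dist: "distinct xs"
    unfolding xs_def by (auto simp del: upt_Suc)
  have seq: "perm_seq n p = xs"
    unfolding perm_seq_def p_def
    by (rule nth_equalityI) (auto simp: len simp del: upt_Suc)
  have "p ` {1..n} = {1..n}"
    using seq set_xs unfolding perm_seq_def
    by (metis atLeastLessThanSuc_atLeastAtMost set_map set_upt)
  then have "bij_betw p {1..n} {1..n}"
    by (simp add: bij_betw_def eq_card_imp_inj_on)
  then have "p permutes {1..n}"
    by (rule bij_imp_permutes) (auto simp: p_def)
  moreover have "sorted_wrt (<) (map key xs)"
  proof -
    have "distinct (map key xs)" using dist assms set_xs by (simp add: distinct_map)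
    moreover have "sorted (map key xs)" by (simp add: xs_def)
    ultimately show ?thesis by (simp add: strict_sorted_iff)
  qed
  ultimately show ?thesis using seq by (auto simp: sorted_wrt_map)
qed

lemma subseq_sorted_wrt:
  assumes "subseq xs ys" "sorted_wrt R ys"
  shows "sorted_wrt R xs"
  using assms
proof induction
  case (list_emb_Cons2 x y xs ys)
  have "set xs \<subseteq> set ys"
    by (blast elim: list_emb_set[OF list_emb_Cons2.hyps(2)])
  with list_emb_Cons2 show ?case by auto
qed auto

lemma length_le_card_key_sum:
  fixes f g :: "'a \<Rightarrow> int"
  assumes "sorted_wrt (\<lambda>x y. f x < f y) a" "sorted_wrt (\<lambda>x y. g x < g y) a"
  shows "length a \<le> card ((\<lambda>x. f x + g x) ` set a)"
proof -
  have "sorted_wrt (\<lambda>x y. f x + g x < f y + g y) a"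
    using assms by (induction a) force+
  then have "sorted_wrt (<) (map (\<lambda>x. f x + g x) a)"
    by (simp add: sorted_wrt_map)
  then have "distinct (map (\<lambda>x. f x + g x) a)"
    by (simp only: strict_sorted_iff)
  from distinct_card[OF this] show ?thesis by simp
qed

text \<open>Sign vectors that pairwise agree in few places (a binary code with large distances) give
  permutations without long common subsequences.\<close>

lemma lcs_bound_le_power:
  fixes s :: "nat \<Rightarrow> nat \<Rightarrow> int"
  assumes "k \<ge> 2" and b: "b > 0" and n: "n \<le> b ^ d"
    and sgn: "\<And>i c. i \<in> {1..k} \<Longrightarrow> c < d \<Longrightarrow> s i c \<in> {1, -1}"
    and agree: "\<And>i j. i \<in> {1..k} \<Longrightarrow> j \<in> {1..k} \<Longrightarrow> i \<noteq> j \<Longrightarrow>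
                  card {c. c < d \<and> s i c = s j c} \<le> m"
  shows "lcs_bound k n \<le> b ^ m"
proof -
  let ?W = "{..<d} \<rightarrow>\<^sub>E {..<b}"
  have "finite ?W" by (intro finite_PiE) auto
  moreover have "card {1..n} \<le> card ?W" using n by (simp add: card_PiE)
  ultimately obtain word where word: "word ` {1..n} \<subseteq> ?W" "inj_on word {1..n}"
    using card_le_inj[of "{1..n}" ?W] by blast
  define key where "key i x = signed_value b d (s i) (word x)" for i x
  have "inj_on (key i) {1..n}" if "i \<in> {1..k}" for i
  proof -
    have "inj_on (signed_value b d (s i)) ?W"
      by (rule inj_on_signed_value) (rule sgn[OF that])
    then have "inj_on (signed_value b d (s i)) (word ` {1..n})"
      using word(1) by (rule inj_on_subset)
    then show ?thesis
      using comp_inj_on[OF word(2)] by (simp add: key_def[abs_def] comp_def)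
  qed
  then have "\<forall>i\<in>{1..k}. \<exists>p. p permutes {1..n}
               \<and> sorted_wrt (\<lambda>x y. key i x < key i y) (perm_seq n p)"
    using ex_permutation_sorted_by_key by blast
  then obtain \<pi> where \<pi>: "\<And>i. i \<in> {1..k} \<Longrightarrow> \<pi> i permutes {1..n}"
      "\<And>i. i \<in> {1..k} \<Longrightarrow> sorted_wrt (\<lambda>x y. key i x < key i y) (perm_seq n (\<pi> i))"
    by metis
  have "perm_family k n \<pi>" using \<pi>(1) by (simp add: perm_family_def)
  then obtain a where a: "common_subseq k n \<pi> a" "length a = lcs_bound k n"
    using lcs_bound_is_maximum(1)[OF \<open>k \<ge> 2\<close>] by blast
  then obtain i j where ij: "i \<in> {1..k}" "j \<in> {1..k}" "i \<noteq> j"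
      "subseq a (perm_seq n (\<pi> i))" "subseq a (perm_seq n (\<pi> j))"
    unfolding common_subseq_def by blast
  have "set (perm_seq n (\<pi> i)) = {1..n}"
    using permutes_image[OF \<pi>(1)[OF ij(1)]]
    by (simp add: perm_seq_def atLeastLessThanSuc_atLeastAtMost del: upt_Suc)
  then have "set a \<subseteq> {1..n}"
    by (blast elim: list_emb_set[OF ij(4)])
  then have words_a: "word ` set a \<subseteq> ?W" using word(1) by blast
  have "length a \<le> card ((\<lambda>x. key i x + key j x) ` set a)"
    by (rule length_le_card_key_sum)
      (rule subseq_sorted_wrt[OF ij(4) \<pi>(2)[OF ij(1)]] subseq_sorted_wrt[OF ij(5) \<pi>(2)[OF ij(2)]])+
  also have "\<dots> = card ((\<lambda>w. signed_value b d (s i) w + signed_value b d (s j) w)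
                    ` word ` set a)"
    by (simp add: key_def image_image)
  also have "\<dots> \<le> b ^ card {c. c < d \<and> s i c = s j c}"
    by (rule card_signed_value_sum_le[OF sgn[OF ij(1)] sgn[OF ij(2)] words_a])
  also have "\<dots> \<le> b ^ m"
    using agree[OF ij(1-3)] b by (intro power_increasing) auto
  finally show ?thesis using a(2) by simp
qed

section \<open>Sign vectors from a Hadamard matrix\<close>

text \<open>Multiplying both rows by their entries in column \<open>0\<close> either preserves all disagreements
  or, if those entries differ, exchanges agreements and disagreements.  The disagreements number
  \<open>k/2\<close>, half of the columns, so \<open>k/2\<close> columns agree afterwards in both cases, column \<open>0\<close> among
  them.\<close>

lemma hadamard_normalized_agreements:
  assumes H: "hadamard_matrix k H" and ij: "i < k" "j < k" "i \<noteq> j"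
  shows "card {c. c < k - 1 \<and> H $$ (i, 0) * H $$ (i, Suc c) = H $$ (j, 0) * H $$ (j, Suc c)}
           = k div 2 - 1"
proof -
  let ?D = "{c. c < k \<and> H $$ (i, c) \<noteq> H $$ (j, c)}"
  let ?E = "{c. c < k \<and> H $$ (i, 0) * H $$ (i, c) = H $$ (j, 0) * H $$ (j, c)}"
  let ?B = "{c. c < k - 1 \<and> H $$ (i, 0) * H $$ (i, Suc c) = H $$ (j, 0) * H $$ (j, Suc c)}"
  have ent: "H $$ (i, c) \<in> {1, -1}" "H $$ (j, c) \<in> {1, -1}" if "c < k" for c
    using H ij that by (auto simp: hadamard_matrix_def)
  have "real (card ?D) = real k / 2"
    using H ij by (simp add: hadamard_matrix_def)
  then have D: "2 * card ?D = k" by linarith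
  have "card ({..<k} - ?D) = k - card ?D"
    by (subst card_Diff_subset) auto
  then have compl: "card ({..<k} - ?D) = card ?D" using D by simp
  have "?E = {..<k} - ?D \<or> ?E = ?D"
  proof (cases "H $$ (i, 0) = H $$ (j, 0)")
    case True
    then have "?E = {..<k} - ?D" using ent(2)[of 0] ij by auto
    then show ?thesis ..
  next
    case False
    have "H $$ (i, 0) * H $$ (i, c) = H $$ (j, 0) * H $$ (j, c)
            \<longleftrightarrow> H $$ (i, c) \<noteq> H $$ (j, c)" if "c < k" for c
      using False ent[OF that] ent[of 0] ij by auto
    then have "?E = ?D" by auto
    then show ?thesis ..
  qed
  then have "card ?E = card ?D" using compl by (elim disjE) (simp_all only:)
  moreover have "?E = insert 0 (Suc ` ?B)"
  proof (rule Set.set_eqI)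
    fix c show "c \<in> ?E \<longleftrightarrow> c \<in> insert 0 (Suc ` ?B)"
      using ent[of 0] ij by (cases c) auto
  qed
  then have "card ?E = Suc (card ?B)" by (simp add: card_image)
  ultimately show ?thesis using D by linarith
qed

theorem theorem1:
  fixes k n :: nat
  assumes "k \<ge> 4" and "\<exists>H. hadamard_matrix k H" and "n \<ge> 1"
  shows "int (lcs_bound k n) \<le> \<lceil>real n powr (1 / (real k - 1))\<rceil> ^ (k div 2 - 1)"
proof -
  obtain H where H: "hadamard_matrix k H" using assms(2) by blast
  let ?r = "real n powr (1 / (real k - 1))"
  define b where "b = nat \<lceil>?r\<rceil>"
  have "?r > 0" using assms(3) by simp
  then have b: "b > 0" "int b = \<lceil>?r\<rceil>" unfolding b_def by linarith+
  have "real n = ?r powr real (k - 1)"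
    using assms by (simp add: powr_powr of_nat_diff)
  also have "\<dots> = ?r ^ (k - 1)" using \<open>?r > 0\<close> by (rule powr_realpow)
  also have "\<dots> \<le> real b ^ (k - 1)"
    using \<open>?r > 0\<close> by (intro power_mono) (auto simp: b_def real_nat_ceiling_ge)
  finally have n: "n \<le> b ^ (k - 1)" by (metis of_nat_le_iff of_nat_power)
  define s where "s i c = H $$ (i - 1, 0) * H $$ (i - 1, Suc c)" for i c
  have entry: "H $$ (i, c) \<in> {1, -1}" if "i < k" "c < k" for i c
    using H that by (auto simp: hadamard_matrix_def)
  have "lcs_bound k n \<le> b ^ (k div 2 - 1)"
  proof (rule lcs_bound_le_power[OF _ b(1) n, where s = s])
    show "k \<ge> 2" using assms(1) by simp
    show "s i c \<in> {1, -1}" if "i \<in> {1..k}" "c < k - 1" for i c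
    proof -
      have "i - 1 < k" "0 < k" "Suc c < k" using that by auto
      then show ?thesis using entry[of "i - 1" 0] entry[of "i - 1" "Suc c"] by (auto simp: s_def)
    qed
    show "card {c. c < k - 1 \<and> s i c = s j c} \<le> k div 2 - 1"
      if "i \<in> {1..k}" "j \<in> {1..k}" "i \<noteq> j" for i j
    proof -
      have "i - 1 < k" "j - 1 < k" "i - 1 \<noteq> j - 1" using that by auto
      then show ?thesis
        unfolding s_def using hadamard_normalized_agreements[OF H] by simp
    qed
  qed
  then have "int (lcs_bound k n) \<le> int b ^ (k div 2 - 1)"
    by (metis of_nat_le_iff of_nat_power)
  then show ?thesis by (simp add: b(2))
qed

end
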